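(* Let $\Omega\subset\mathbb{R}^2$ be a bounded domain with periodic boundary conditions on $\partial\Omega$, let $g>0$ and $\Delta t>0$, and let $b=b(\mathbf{x})$ be an arbitrary given time-independent bottom bathymetry, not identically zero. Let $\eta_0$ be a constant (with $\eta_0-b(\mathbf{x})\ge 0$ on $\Omega$), and consider the initial condition $$\eta(\mathbf{x},0)=\eta_0,\qquad \mathbf{v}(\mathbf{x},0)=\mathbf{0},\qquad b(\mathbf{x})\not\equiv 0 .$$ Consider the semi-discrete (in time) scheme which, given $\eta^n$, $\mathbf{v}^n$, $H^n=\eta^n-b$ and $\mathbf{q}^n=H^n\mathbf{v}^n$, determines $\eta^{n+1}$ and $\mathbf{q}^{n+1}$ by $$\eta^{n+1}-\Delta t^2\, g\,\nabla\cdot\left(H^n\nabla\eta^{n+1}\right)=\eta^n-\Delta t\,\nabla\cdot\mathbf{q}^*,\qquad \mathbf{q}^*=\mathbf{q}^n-\Delta t\,\nabla\cdot\left(\mathbf{v}^n\otimes\mathbf{q}^n\right),$$ $$\mathbf{q}^{n+1}=\mathbf{q}^*-\Delta t\, g\,H^n\,\nabla\eta^{n+1}.$$ Then the scheme is well-balanced: started from the initial condition $\eta(\mathbf{x},0)=\eta_0$, $\mathbf{v}(\mathbf{x},0)=\mathbf{0}$ with bathymetry $b(\mathbf{x})\not\equiv 0$, it preserves the stationary solution for arbitrary bathymetry, that is, $\eta^{n}=\eta_0$ and $\mathbf{q}^{n}=\mathbf{0}$ for all $n\ge 0$.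
   Context: The frictionless shallow water equations are $$\partial_t\eta+\nabla\cdot\mathbf{q}=0,\qquad \partial_t\mathbf{q}+\nabla\cdot(\mathbf{v}\otimes\mathbf{q})+gH\nabla\eta=\mathbf{0},\qquad \partial_t b=0,$$ where $\eta(\mathbf{x},t)$ is the free surface elevation, $b(\mathbf{x})$ the prescribed bottom bathymetry, $H=\eta-b\ge 0$ the total water depth, $\mathbf{v}=(u,v)$ the velocity, $\mathbf{q}=H\mathbf{v}$ the flow discharge, and $g$ the gravity acceleration. A superscript $n$ denotes the approximation at time $t^n$, with $t^{n+1}=t^n+\Delta t$; space is kept continuous, and all functions are periodic on $\Omega$ and regular enough for the expressions in the scheme to make sense. The scheme is obtained from $$\frac{\eta^{n+1}-\eta^n}{\Delta t}+\nabla\cdot\mathbf{q}^{n+1}=0,\qquad \frac{\mathbf{q}^{n+1}-\mathbf{q}^n}{\Delta t}+\nabla\cdot(\mathbf{v}^n\otimes\mathbf{q}^n)+gH^n\nabla\eta^{n+1}=\mathbf{0}$$ by substituting the second equation into the first. Well-balanced (C-property, in the sense of LeVeque) means that the scheme exactly preserves the "lake at rest" equilibria, i.e. states with constant free surface elevation and zero velocity over an arbitrary bottom topography. *)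

theory Defs
  imports "HOL-Analysis.Analysis"
begin

section \<open>Periodic domains in the plane\<close>

text \<open>
  Boundary conditions are periodic with respect to the lattice spanned by the columns of an
  invertible matrix P. A periodic function on a domain is represented by its periodic extension
  to the plane, so that derivatives on the boundary are those of the extension and all pointwise
  conditions are imposed on the closure of the domain.
\<close>

definition integer_vectors :: "(real^2) set" where
  "integer_vectors = {k. \<forall>i. k $ i \<in> \<int>}"

definition periodic :: "real^2^2 \<Rightarrow> (real^2 \<Rightarrow> 'a) \<Rightarrow> bool" where
  "periodic P f \<longleftrightarrow> (\<forall>k\<in>integer_vectors. \<forall>x. f (x + P *v k) = f x)"

text \<open>
  The bounded domain is a fundamental cell of the lattice: its translates are disjoint and their
  closures cover the plane. For a diagonal P with positive entries \<open>L1\<close>, \<open>L2\<close> the open rectangle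
  with sides \<open>L1\<close>, \<open>L2\<close> is such a domain.
\<close>

definition periodic_domain :: "real^2^2 \<Rightarrow> (real^2) set \<Rightarrow> bool" where
  "periodic_domain P \<Omega> \<longleftrightarrow>
     invertible P \<and> open \<Omega> \<and> connected \<Omega> \<and> bounded \<Omega> \<and>
     (\<forall>k\<in>integer_vectors. k \<noteq> 0 \<longrightarrow> (\<lambda>x. x + P *v k) ` \<Omega> \<inter> \<Omega> = {}) \<and>
     (\<forall>x. \<exists>k\<in>integer_vectors. x + P *v k \<in> closure \<Omega>)"

section \<open>Differential operators\<close>

definition grad :: "(real^2 \<Rightarrow> real) \<Rightarrow> real^2 \<Rightarrow> real^2" where
  "grad f x = (\<chi> i. frechet_derivative f (at x) (axis i 1))"

definition divergence :: "(real^2 \<Rightarrow> real^2) \<Rightarrow> real^2 \<Rightarrow> real" where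
  "divergence F x = (\<Sum>i\<in>UNIV. frechet_derivative F (at x) (axis i 1) $ i)"

text \<open>
  The divergence of a tensor field is taken row by row: component i is the sum over j of the
  derivative of \<open>T $ i $ j\<close> in direction j. The tensor in the scheme is symmetric because the
  discharge is a scalar multiple of the velocity, so contracting the other index gives the same.
\<close>

definition tensor_divergence :: "(real^2 \<Rightarrow> real^2^2) \<Rightarrow> real^2 \<Rightarrow> real^2" where
  "tensor_divergence T x = (\<chi> i. divergence (\<lambda>y. T y $ i) x)"

definition outer :: "real^2 \<Rightarrow> real^2 \<Rightarrow> real^2^2" where
  "outer a c = (\<chi> i j. a $ i * c $ j)"

section \<open>The semi-implicit scheme\<close>

definition q_star ::
  "real \<Rightarrow> (real^2 \<Rightarrow> real^2) \<Rightarrow> (real^2 \<Rightarrow> real^2) \<Rightarrow> real^2 \<Rightarrow> real^2" where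
  "q_star dt v q x = q x - dt *\<^sub>R tensor_divergence (\<lambda>y. outer (v y) (q y)) x"

text \<open>
  One time step from \<open>(\<eta>, v, q)\<close> to \<open>(\<eta>', q')\<close>. Since \<open>frechet_derivative\<close> is unspecified where
  a function is not differentiable, the step requires every function that the scheme
  differentiates to be differentiable.
\<close>

definition scheme_step ::
  "(real^2) set \<Rightarrow> real \<Rightarrow> real \<Rightarrow> (real^2 \<Rightarrow> real) \<Rightarrow>
   (real^2 \<Rightarrow> real) \<Rightarrow> (real^2 \<Rightarrow> real^2) \<Rightarrow> (real^2 \<Rightarrow> real^2) \<Rightarrow>
   (real^2 \<Rightarrow> real) \<Rightarrow> (real^2 \<Rightarrow> real^2) \<Rightarrow> bool" where
  "scheme_step \<Omega> g dt b \<eta> v q \<eta>' q' \<longleftrightarrow>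
     (let H = (\<lambda>x. \<eta> x - b x) in
      \<forall>x\<in>closure \<Omega>.
        (\<lambda>y. outer (v y) (q y)) differentiable (at x) \<and>
        q_star dt v q differentiable (at x) \<and>
        \<eta>' differentiable (at x) \<and>
        (\<lambda>y. H y *\<^sub>R grad \<eta>' y) differentiable (at x) \<and>
        \<eta>' x - dt\<^sup>2 * g * divergence (\<lambda>y. H y *\<^sub>R grad \<eta>' y) x
          = \<eta> x - dt * divergence (q_star dt v q) x \<and>
        q' x = q_star dt v q x - (dt * g * H x) *\<^sub>R grad \<eta>' x)"

text \<open>
  A run of the scheme. The velocity is linked to the discharge only by \<open>q = H v\<close>, which leaves it
  unconstrained at dry points (\<open>H = 0\<close>).
\<close>

definition scheme_run ::
  "real^2^2 \<Rightarrow> (real^2) set \<Rightarrow> real \<Rightarrow> real \<Rightarrow> (real^2 \<Rightarrow> real) \<Rightarrow>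
   (nat \<Rightarrow> real^2 \<Rightarrow> real) \<Rightarrow> (nat \<Rightarrow> real^2 \<Rightarrow> real^2) \<Rightarrow> (nat \<Rightarrow> real^2 \<Rightarrow> real^2) \<Rightarrow> bool" where
  "scheme_run P \<Omega> g dt b \<eta> v q \<longleftrightarrow>
     (\<forall>n. periodic P (\<eta> n) \<and> periodic P (v n) \<and> periodic P (q n) \<and>
          (\<forall>x\<in>closure \<Omega>. q n x = (\<eta> n x - b x) *\<^sub>R v n x) \<and>
          scheme_step \<Omega> g dt b (\<eta> n) (v n) (q n) (\<eta> (Suc n)) (q (Suc n)))"

end

theory Submission
  imports Defs
begin

text \<open>
  A step that starts from a lake at rest has \<open>q\<^sup>* = 0\<close>, so its new elevation \<open>w\<close> solves
  \<open>w - c \<nabla>\<sqdot>(H \<nabla>w) = \<eta>\<^sub>0\<close> with \<open>c > 0\<close> and \<open>H \<ge> 0\<close>. The constant \<open>\<eta>\<^sub>0\<close> is a solution; the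
  content of the theorem is that it is the only periodic one. Since \<open>H\<close> may vanish and inherits
  no regularity from the arbitrary bathymetry, neither uniform ellipticity nor an expansion
  \<open>H \<Delta>w + \<nabla>H \<sqdot> \<nabla>w\<close> is at hand, and an energy argument would need an integration by parts for a
  flux that is merely differentiable. A maximum principle avoids all this.

  At a maximum point of \<open>w\<close> the flux \<open>H \<nabla>w\<close> vanishes. If its divergence were positive there,
  some component of the flux would become positive in the corresponding coordinate direction;
  as \<open>H \<ge> 0\<close>, the matching partial derivative of \<open>w\<close> would be positive too, and \<open>w\<close> would exceed
  its maximum (\<open>divergence_nonpos_at_max\<close>). So the equation gives \<open>w \<le> \<eta>\<^sub>0\<close> at a maximum
  point, and \<open>w \<ge> \<eta>\<^sub>0\<close> at a minimum point by symmetry; both exist by periodicity and compactness.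
  Hence \<open>w = \<eta>\<^sub>0\<close> (\<open>elliptic_solution_constant\<close>), its gradient is zero, and so is the new discharge.
  The velocity can be arbitrary at dry points in later steps, but it enters only through
  \<open>v \<otimes> q\<close>, which is zero with \<open>q\<close>.
\<close>

section \<open>Constant fields\<close>

lemma grad_const [simp]: "grad (\<lambda>x. c) = (\<lambda>x. 0)"
  by (simp add: grad_def fun_eq_iff vec_eq_iff)

lemma divergence_zero [simp]: "divergence (\<lambda>x. 0) = (\<lambda>x. 0)"
  by (simp add: divergence_def fun_eq_iff)

lemma outer_zero_right [simp]: "outer a 0 = 0"
  by (simp add: outer_def vec_eq_iff)

lemma q_star_zero_discharge [simp]: "q_star dt v (\<lambda>x. 0) = (\<lambda>x. 0)"
  by (simp add: q_star_def tensor_divergence_def fun_eq_iff vec_eq_iff)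

lemma grad_uminus:
  assumes "f differentiable (at x)"
  shows "grad (\<lambda>y. - f y) x = - grad f x"
  using frechet_derivative_at[OF has_derivative_minus[OF assms[unfolded frechet_derivative_works]]]
  by (simp add: grad_def vec_eq_iff fun_eq_iff)

lemma divergence_uminus:
  assumes "F differentiable (at x)"
  shows "divergence (\<lambda>y. - F y) x = - divergence F x"
  using frechet_derivative_at[OF has_derivative_minus[OF assms[unfolded frechet_derivative_works]], symmetric]
  by (simp add: divergence_def sum_negf)

section \<open>Periodic functions\<close>

text \<open>
  The equations of a run hold on the closure of the cell only, whereas derivatives at its boundary
  see a full neighbourhood; periodicity carries pointwise information to the whole plane.
\<close>

lemma periodic_cell_representative:
  assumes "periodic_domain P \<Omega>"
  obtains y p where "y \<in> closure \<Omega>" "x = y + p"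
    "\<And>f :: real^2 \<Rightarrow> 'a. periodic P f \<Longrightarrow> (\<forall>z. f (z + p) = f z)"
proof -
  obtain k where k: "k \<in> integer_vectors" "x + P *v k \<in> closure \<Omega>"
    using assms unfolding periodic_domain_def by blast
  show ?thesis
  proof (rule that[OF k(2), of "- (P *v k)"])
    show "x = x + P *v k + - (P *v k)" by simp
    fix f :: "real^2 \<Rightarrow> 'a" assume f: "periodic P f"
    show "\<forall>z. f (z + - (P *v k)) = f z"
    proof
      fix z
      have "f ((z + - (P *v k)) + P *v k) = f (z + - (P *v k))"
        using f k(1) unfolding periodic_def by blast
      then show "f (z + - (P *v k)) = f z" by simp
    qed
  qed
qed

lemma periodic_all_iff_cell:
  assumes "periodic_domain P \<Omega>" "periodic P f"
  shows "(\<forall>x. Q (f x)) \<longleftrightarrow> (\<forall>x\<in>closure \<Omega>. Q (f x))"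
proof
  assume cell: "\<forall>x\<in>closure \<Omega>. Q (f x)"
  show "\<forall>x. Q (f x)"
  proof
    fix x
    obtain y p where "y \<in> closure \<Omega>" "x = y + p" "\<forall>z. f (z + p) = f z"
      by (rule periodic_cell_representative[OF assms(1), of x]) (use assms(2) in blast)
    then show "Q (f x)"
      using cell by simp
  qed
qed blast

lemma periodic_differentiable:
  fixes f :: "real^2 \<Rightarrow> 'a::real_normed_vector"
  assumes "periodic_domain P \<Omega>" "periodic P f" "\<forall>x\<in>closure \<Omega>. f differentiable (at x)"
  shows "f differentiable (at x)"
proof -
  obtain y p where yp: "y \<in> closure \<Omega>" "x = y + p" and per: "\<forall>z. f (z + p) = f z"
    by (rule periodic_cell_representative[OF assms(1), of x]) (use assms(2) in blast)
  have "f (z - p) = f z" for z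
    using per[rule_format, of "z - p"] by simp
  then have shift: "(\<lambda>z. f (z - p)) = f"
    by (rule ext)
  have "f differentiable (at (x - p))"
    using assms(3) yp by simp
  moreover have "(\<lambda>z. z - p) differentiable (at x)"
    by simp
  ultimately have "(\<lambda>z. f (z - p)) differentiable (at x)"
    using differentiable_chain_at[of "\<lambda>z. z - p" x f] by (simp add: o_def)
  then show ?thesis
    by (simp only: shift)
qed

lemma periodic_attains_max:
  fixes f :: "real^2 \<Rightarrow> real"
  assumes dom: "periodic_domain P \<Omega>" and "periodic P f" and "continuous_on (closure \<Omega>) f"
  obtains x0 where "x0 \<in> closure \<Omega>" "\<And>x. f x \<le> f x0"
proof -
  have "compact (closure \<Omega>)"
    using dom by (simp add: periodic_domain_def)
  moreover have "closure \<Omega> \<noteq> {}"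
    by (rule periodic_cell_representative[OF dom]) auto
  ultimately obtain x0 where "x0 \<in> closure \<Omega>" "\<forall>x\<in>closure \<Omega>. f x \<le> f x0"
    using continuous_attains_sup[OF _ _ assms(3)] by blast
  then show ?thesis
    using that[of x0] periodic_all_iff_cell[OF assms(1,2), of "\<lambda>t. t \<le> f x0"] by simp
qed

section \<open>Maximum principle\<close>

lemma has_derivative_along_line:
  assumes "f differentiable (at (x + t *\<^sub>R e))"
  shows "((\<lambda>s. f (x + s *\<^sub>R e)) has_vector_derivative
           frechet_derivative f (at (x + t *\<^sub>R e)) e) (at t)"
proof -
  let ?D = "frechet_derivative f (at (x + t *\<^sub>R e))"
  have D: "(f has_derivative ?D) (at (x + t *\<^sub>R e))"
    using assms frechet_derivative_works by blast
  have "((\<lambda>s. x + s *\<^sub>R e) has_derivative (\<lambda>s. s *\<^sub>R e)) (at t)"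
    by (auto intro!: derivative_eq_intros)
  from has_derivative_compose[OF this D]
  have "((\<lambda>s. f (x + s *\<^sub>R e)) has_derivative (\<lambda>s. ?D (s *\<^sub>R e))) (at t)" .
  then show ?thesis
    using linear_cmul[OF has_derivative_linear[OF D]] by (simp add: has_vector_derivative_def)
qed

lemma grad_eq_0_at_max:
  assumes "w differentiable (at x0)" "\<And>x. w x \<le> w x0"
  shows "grad w x0 = 0"
proof -
  have "(w has_derivative frechet_derivative w (at x0)) (at x0)"
    using assms(1) by (rule frechet_derivative_works[THEN iffD1])
  then have "frechet_derivative w (at x0) = (\<lambda>h. 0)"
    by (rule differential_zero_maxmin[OF UNIV_I open_UNIV]) (use assms(2) in blast)
  then show ?thesis
    by (simp add: grad_def vec_eq_iff)
qed

text \<open>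
  The flux is differentiated as a whole, because the coefficient \<open>H\<close> may be rough. All that \<open>H\<close>
  contributes is its sign: where a component of the flux is positive, so is the same component of
  the gradient, and \<open>w\<close> increases in that direction.
\<close>

lemma divergence_nonpos_at_max:
  assumes w: "\<And>x. w differentiable (at x)"
    and F: "(\<lambda>y. H y *\<^sub>R grad w y) differentiable (at x0)"
    and H: "\<And>x. H x \<ge> 0"
    and max: "\<And>x. w x \<le> w x0"
  shows "divergence (\<lambda>y. H y *\<^sub>R grad w y) x0 \<le> 0"
proof (rule ccontr)
  let ?F = "\<lambda>y. H y *\<^sub>R grad w y"
  let ?D = "frechet_derivative ?F (at x0)"
  assume "\<not> divergence ?F x0 \<le> 0"
  then obtain i where i: "?D (axis i 1) $ i > 0"
    unfolding divergence_def by (meson not_le sum_nonpos)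
  let ?x = "\<lambda>t. x0 + t *\<^sub>R axis i (1::real)"
  have "((\<lambda>t. ?F (?x t) $ i) has_vector_derivative ?D (axis i 1) $ i) (at 0)"
    using bounded_linear.has_vector_derivative[OF bounded_linear_vec_nth
        has_derivative_along_line[of ?F x0 0 "axis i 1"]] F by simp
  then have "((\<lambda>t. ?F (?x t) $ i) has_real_derivative ?D (axis i 1) $ i) (at 0)"
    by (simp add: has_real_derivative_iff_has_vector_derivative)
  from DERIV_pos_inc_right[OF this i] obtain d where d: "d > 0"
    and inc: "\<And>h. 0 < h \<Longrightarrow> h < d \<Longrightarrow> ?F (?x 0) $ i < ?F (?x h) $ i"
    by auto
  have grad_pos: "grad w (?x h) $ i > 0" if "0 < h" "h < d" for h
  proof -
    have "0 < H (?x h) * grad w (?x h) $ i"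
      using inc[OF that] grad_eq_0_at_max[OF w max] by simp
    then show ?thesis
      using H[of "?x h"] by (simp add: zero_less_mult_iff)
  qed
  have deriv: "((\<lambda>t. w (?x t)) has_real_derivative grad w (?x t) $ i) (at t)" for t
    using has_derivative_along_line[of w x0 t "axis i 1", OF w]
    by (simp add: has_real_derivative_iff_has_vector_derivative grad_def)
  obtain z where z: "0 < z" "z < d / 2"
    "w (?x (d / 2)) - w (?x 0) = (d / 2 - 0) * (grad w (?x z) $ i)"
    using MVT2[of 0 "d / 2" "\<lambda>t. w (?x t)" "\<lambda>t. grad w (?x t) $ i"] d deriv by auto
  have "(d / 2 - 0) * (grad w (?x z) $ i) > 0"
    using z d by (intro mult_pos_pos grad_pos) auto
  then have "w (?x (d / 2)) > w x0"
    unfolding z(3)[symmetric] by simp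
  with max[of "?x (d / 2)"] show False
    by simp
qed

lemma elliptic_solution_constant:
  assumes dom: "periodic_domain P \<Omega>" and c: "c > 0"
    and H: "\<And>x. H x \<ge> 0"
    and per: "periodic P w"
    and w: "\<And>x. w differentiable (at x)"
    and F: "\<And>x. x \<in> closure \<Omega> \<Longrightarrow> (\<lambda>y. H y *\<^sub>R grad w y) differentiable (at x)"
    and eq: "\<And>x. x \<in> closure \<Omega> \<Longrightarrow> w x - c * divergence (\<lambda>y. H y *\<^sub>R grad w y) x = a"
  shows "w x = a"
proof (rule antisym)
  have cont: "continuous_on (closure \<Omega>) w"
    by (simp add: continuous_at_imp_continuous_on differentiable_imp_continuous_within w)
  obtain x1 where x1: "x1 \<in> closure \<Omega>" "\<And>x. w x \<le> w x1"
    using periodic_attains_max[OF dom per cont] by blast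
  have "c * divergence (\<lambda>y. H y *\<^sub>R grad w y) x1 \<le> 0"
    using divergence_nonpos_at_max[OF w F[OF x1(1)] H x1(2)] c
    by (simp add: mult_le_0_iff)
  with eq[OF x1(1)] x1(2)[of x] show "w x \<le> a"
    by linarith
  \<comment> \<open>A minimum point of \<open>w\<close> is a maximum point of \<open>-w\<close>, whose flux is the negative one.\<close>
  have "periodic P (\<lambda>x. - w x)"
    using per by (simp add: periodic_def)
  then obtain x2 where x2: "x2 \<in> closure \<Omega>" "\<And>x. - w x \<le> - w x2"
    using periodic_attains_max[OF dom _ continuous_on_minus[OF cont]] by blast
  have flux: "(\<lambda>y. H y *\<^sub>R grad (\<lambda>z. - w z) y) = (\<lambda>y. - (H y *\<^sub>R grad w y))"
    by (simp add: grad_uminus[OF w])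
  have "divergence (\<lambda>y. H y *\<^sub>R grad (\<lambda>z. - w z) y) x2 \<le> 0"
  proof (rule divergence_nonpos_at_max)
    show "(\<lambda>y. H y *\<^sub>R grad (\<lambda>z. - w z) y) differentiable (at x2)"
      unfolding flux by (intro differentiable_minus F x2(1))
  qed (use w H x2(2) in \<open>auto intro: differentiable_minus\<close>)
  then have "c * divergence (\<lambda>y. H y *\<^sub>R grad w y) x2 \<ge> 0"
    using c by (simp add: flux divergence_uminus[OF F[OF x2(1)]])
  with eq[OF x2(1)] x2(2)[of x] show "a \<le> w x"
    by linarith
qed

section \<open>Preservation of the lake at rest\<close>

lemma scheme_step_lake_at_rest:
  assumes dom: "periodic_domain P \<Omega>" and "g > 0" "dt > 0"
    and depth: "\<And>x. \<eta>0 - b x \<ge> 0"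
    and per: "periodic P \<eta>'" "periodic P q'"
    and step: "scheme_step \<Omega> g dt b (\<lambda>x. \<eta>0) v (\<lambda>x. 0) \<eta>' q'"
  shows "\<eta>' = (\<lambda>x. \<eta>0) \<and> q' = (\<lambda>x. 0)"
proof -
  note step' = step[unfolded scheme_step_def Let_def, simplified]
  have "\<eta>' differentiable (at x)" for x
    using periodic_differentiable[OF dom per(1)] step' by blast
  then have \<eta>': "\<eta>' = (\<lambda>x. \<eta>0)"
    using elliptic_solution_constant[OF dom, of "dt\<^sup>2 * g" "\<lambda>x. \<eta>0 - b x" \<eta>' \<eta>0]
      assms(2,3) depth per(1) step' by (auto simp: fun_eq_iff)
  then have "\<forall>x\<in>closure \<Omega>. q' x = 0"
    using step' by simp
  then have "\<forall>x. q' x = 0"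
    using periodic_all_iff_cell[OF dom per(2), of "\<lambda>y. y = 0"] by simp
  with \<eta>' show ?thesis
    by auto
qed

theorem theorem1:
  fixes P :: "real^2^2" and \<Omega> :: "(real^2) set"
    and g dt \<eta>0 :: real and b :: "real^2 \<Rightarrow> real"
  assumes "periodic_domain P \<Omega>"
    and "g > 0" and "dt > 0"
    and "periodic P b"
    and "\<exists>x\<in>closure \<Omega>. b x \<noteq> 0"
    and "\<forall>x\<in>closure \<Omega>. \<eta>0 - b x \<ge> 0"
  shows "scheme_run P \<Omega> g dt b (\<lambda>n x. \<eta>0) (\<lambda>n x. 0) (\<lambda>n x. 0) \<and>
    (\<forall>\<eta> v q. scheme_run P \<Omega> g dt b \<eta> v q \<and>
        (\<forall>x\<in>closure \<Omega>. \<eta> 0 x = \<eta>0 \<and> v 0 x = 0) \<longrightarrow>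
        (\<forall>n. \<forall>x\<in>closure \<Omega>. \<eta> n x = \<eta>0 \<and> q n x = 0))"
proof (intro conjI allI impI)
  show "scheme_run P \<Omega> g dt b (\<lambda>n x. \<eta>0) (\<lambda>n x. 0) (\<lambda>n x. 0)"
    by (simp add: scheme_run_def scheme_step_def periodic_def)
next
  fix \<eta> v q n
  assume "scheme_run P \<Omega> g dt b \<eta> v q \<and> (\<forall>x\<in>closure \<Omega>. \<eta> 0 x = \<eta>0 \<and> v 0 x = 0)"
  then have run: "scheme_run P \<Omega> g dt b \<eta> v q"
    and init: "\<forall>x\<in>closure \<Omega>. \<eta> 0 x = \<eta>0" "\<forall>x\<in>closure \<Omega>. v 0 x = 0"
    by auto
  have per: "periodic P (\<eta> n)" "periodic P (q n)" for n
    using run unfolding scheme_run_def by auto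
  have depth: "\<eta>0 - b x \<ge> 0" for x
    using periodic_all_iff_cell[OF assms(1,4), of "\<lambda>t. \<eta>0 - t \<ge> 0"] assms(6) by blast
  have "\<eta> n = (\<lambda>x. \<eta>0) \<and> q n = (\<lambda>x. 0)"
  proof (induction n)
    case 0
    have "\<forall>x\<in>closure \<Omega>. q 0 x = 0"
      using run init(2) unfolding scheme_run_def by auto
    then show ?case
      using init(1) periodic_all_iff_cell[OF assms(1) per(1)[of 0], of "\<lambda>t. t = \<eta>0"]
        periodic_all_iff_cell[OF assms(1) per(2)[of 0], of "\<lambda>t. t = 0"]
      by (simp add: fun_eq_iff)
  next
    case (Suc n)
    have "scheme_step \<Omega> g dt b (\<eta> n) (v n) (q n) (\<eta> (Suc n)) (q (Suc n))"
      using run unfolding scheme_run_def by blast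
    then show ?case
      using scheme_step_lake_at_rest[OF assms(1-3) depth per] Suc.IH by simp
  qed
  then show "\<forall>x\<in>closure \<Omega>. \<eta> n x = \<eta>0 \<and> q n x = 0"
    by simp
qed

end
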